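(* Let $G$ be a group acting (cofinitely) on a finitary semimatroid $\mathcal S=(S,\mathcal C,\mathrm{rk})$, let $\mathfrak S$ denote the resulting $G$-semimatroid, and let $E_{\mathfrak S}$, $\underline{\mathcal C}$, $\underline{\mathrm{rk}}$ be as defined in the context. Then the pair $(E_{\mathfrak S},\underline{\mathrm{rk}})$ is a polymatroid. This polymatroid is a matroid if and only if the action is weakly translative. If the action is weakly translative, then the triple $\mathcal S_{\mathfrak S}:=(E_{\mathfrak S},\underline{\mathcal C},\underline{\mathrm{rk}})$ is a locally ranked triple satisfying (CR2); and, in this case, $\mathcal S_{\mathfrak S}$ is a matroid if and only if $\mathfrak S$ is centered.
   Context: A finitary semimatroid is a triple $\mathcal S=(S,\mathcal C,\mathrm{rk})$ where $S$ is a (possibly infinite) set, $\mathcal C$ is a non-empty finite-dimensional simplicial complex on $S$ (a family of finite subsets of $S$, of bounded cardinality, closed under taking subsets) with $\{x\}\in\mathcal C$ for all $x\in S$, and $\mathrm{rk}:\mathcal C\to\mathbb N=\{0,1,2,\dots\}$ is a bounded function such that: (R1) $0\le \mathrm{rk}(X)\le |X|$ for $X\in\mathcal C$; (R2) if $X\subseteq Y$ in $\mathcal C$ then $\mathrm{rk}(X)\le\mathrm{rk}(Y)$; (R3) if $X,Y,X\cup Y\in\mathcal C$ then $\mathrm{rk}(X)+\mathrm{rk}(Y)\ge \mathrm{rk}(X\cup Y)+\mathrm{rk}(X\cap Y)$; (CR1) if $X,Y\in\mathcal C$ and $\mathrm{rk}(X)=\mathrm{rk}(X\cap Y)$ then $X\cup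 Y\in\mathcal C$; (CR2) if $X,Y\in\mathcal C$ and $\mathrm{rk}(X)<\mathrm{rk}(Y)$ then $X\cup\{y\}\in\mathcal C$ for some $y\in Y\setminus X$. A triple $(S,\mathcal C,\mathrm{rk})$ consisting of a (possibly infinite) set $S$, a non-empty finite-dimensional simplicial complex $\mathcal C$ on $S$ with $\{x\}\in\mathcal C$ for all $x\in S$, and a bounded function $\mathrm{rk}:\mathcal C\to\mathbb N$, only known to satisfy (R1), (R2), (R3), is called a locally ranked triple. Elements of $\mathcal C$ are called central sets. A matroid is a finite semimatroid (finite ground set) in which every subset of the ground set is central; equivalently a finite set $E$ with a function $2^E\to\mathbb N$ satisfying (R1),(R2),(R3). A polymatroid is a finite set $E$ with a function $2^E\to \mathbb N$ satisfying (R2), (R3) and taking value $0$ on $\emptyset$. A $G$-semimatroid $\mathfrak S$ is a finitary semimatroid $\mathcal S=(S,\mathcal C,\mathrm{rk})$ with an action of the group $G$ on the set $S$ whose induced action on $2^S$ preserves centrality and rank. For $X\subseteq S$ let $\underline X:=\{Gx: x\in X\}\subseteq S/G$. Put $E_{\mathfrak S}:=S/G$ (set of orbits), $\mathcal C_{\mathfrak S}:=\mathcal C/G$, $\underline{\mathcal C}:=\{\underline X: X\in\mathcal C\}$, and for $A\subseteq E_{\mathfrak S}$ put $\underline{\mathrm{rk}}(A):=\max\{\mathrm{rk}(X): X\in\mathcal C,\ \underline X\subseteq A\}$. The action is cofinite if $\mathcal C_{\mathfrak S}$ is finite (so $E_{\mathfrak S}$ is finite); centered if there is $X\in\mathcal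 C$ with $\underline X=E_{\mathfrak S}$; weakly translative if for all $g\in G$, $x\in S$, $\{x,g(x)\}\in\mathcal C$ implies $\mathrm{rk}(\{x,g(x)\})=\mathrm{rk}(\{x\})$. *)

theory Defs
  imports "HOL-Algebra.Group_Action"
begin

section \<open>Locally ranked triples and finitary semimatroids\<close>

locale findim_simplicial_complex =
  fixes S :: "'a set" and C :: "'a set set"
  assumes nonempty: "C \<noteq> {}"
    and subset_ground: "X \<in> C \<Longrightarrow> X \<subseteq> S"
    and finite_simplex: "X \<in> C \<Longrightarrow> finite X"
    and bounded_card: "\<exists>d. \<forall>X\<in>C. card X \<le> d"
    and down_closed: "\<lbrakk>X \<in> C; Y \<subseteq> X\<rbrakk> \<Longrightarrow> Y \<in> C"
    and singletons: "x \<in> S \<Longrightarrow> {x} \<in> C"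

text \<open>A rank function on \<open>C\<close> is a total function on sets of which only the values on \<open>C\<close> matter.
  The bound \<open>0 \<le> rk X\<close> in \<open>R1\<close> is automatic in type \<^typ>\<open>nat\<close>.\<close>

definition R1 :: "'a set set \<Rightarrow> ('a set \<Rightarrow> nat) \<Rightarrow> bool" where
  "R1 C rk \<longleftrightarrow> (\<forall>X\<in>C. rk X \<le> card X)"

definition R2 :: "'a set set \<Rightarrow> ('a set \<Rightarrow> nat) \<Rightarrow> bool" where
  "R2 C rk \<longleftrightarrow> (\<forall>X\<in>C. \<forall>Y\<in>C. X \<subseteq> Y \<longrightarrow> rk X \<le> rk Y)"

definition R3 :: "'a set set \<Rightarrow> ('a set \<Rightarrow> nat) \<Rightarrow> bool" where
  "R3 C rk \<longleftrightarrow>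
    (\<forall>X\<in>C. \<forall>Y\<in>C. X \<union> Y \<in> C \<longrightarrow> rk X + rk Y \<ge> rk (X \<union> Y) + rk (X \<inter> Y))"

definition CR1 :: "'a set set \<Rightarrow> ('a set \<Rightarrow> nat) \<Rightarrow> bool" where
  "CR1 C rk \<longleftrightarrow> (\<forall>X\<in>C. \<forall>Y\<in>C. rk X = rk (X \<inter> Y) \<longrightarrow> X \<union> Y \<in> C)"

definition CR2 :: "'a set set \<Rightarrow> ('a set \<Rightarrow> nat) \<Rightarrow> bool" where
  "CR2 C rk \<longleftrightarrow> (\<forall>X\<in>C. \<forall>Y\<in>C. rk X < rk Y \<longrightarrow> (\<exists>y \<in> Y - X. X \<union> {y} \<in> C))"

locale locally_ranked_triple = findim_simplicial_complex S C
  for S :: "'a set" and C :: "'a set set" +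
  fixes rk :: "'a set \<Rightarrow> nat"
  assumes bounded_rank: "\<exists>r. \<forall>X\<in>C. rk X \<le> r"
    and R1: "R1 C rk"
    and R2: "R2 C rk"
    and R3: "R3 C rk"

locale finitary_semimatroid = locally_ranked_triple S C rk
  for S :: "'a set" and C :: "'a set set" and rk :: "'a set \<Rightarrow> nat" +
  assumes CR1: "CR1 C rk"
    and CR2: "CR2 C rk"


section \<open>Matroids and polymatroids\<close>

text \<open>Matroids occur in two guises: as triples (finite semimatroids in which every subset of the
  ground set is central) and as pairs of a finite set and a rank function on its power set. The
  lemma below shows that they agree.\<close>

definition matroid_triple :: "'a set \<Rightarrow> 'a set set \<Rightarrow> ('a set \<Rightarrow> nat) \<Rightarrow> bool" where
  "matroid_triple E C rk \<longleftrightarrow> finite E \<and> finitary_semimatroid E C rk \<and> (\<forall>A. A \<subseteq> E \<longrightarrow> A \<in> C)"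

definition matroid :: "'a set \<Rightarrow> ('a set \<Rightarrow> nat) \<Rightarrow> bool" where
  "matroid E rk \<longleftrightarrow> finite E \<and> R1 (Pow E) rk \<and> R2 (Pow E) rk \<and> R3 (Pow E) rk"

definition polymatroid :: "'a set \<Rightarrow> ('a set \<Rightarrow> nat) \<Rightarrow> bool" where
  "polymatroid E rk \<longleftrightarrow> finite E \<and> R2 (Pow E) rk \<and> R3 (Pow E) rk \<and> rk {} = 0"

lemma matroid_triple_iff: "matroid_triple E C rk \<longleftrightarrow> C = Pow E \<and> matroid E rk"
proof
  assume m: "matroid_triple E C rk"
  then interpret finitary_semimatroid E C rk
    by (simp add: matroid_triple_def)
  have "C = Pow E"
    using m subset_ground by (auto simp: matroid_triple_def)
  then show "C = Pow E \<and> matroid E rk"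
    using m R1 R2 R3 by (simp add: matroid_triple_def matroid_def)
next
  assume a: "C = Pow E \<and> matroid E rk"
  then have fin: "finite E" and C: "C = Pow E"
    and R: "R1 C rk" "R2 C rk" "R3 C rk"
    by (auto simp: matroid_def)
  have "finitary_semimatroid E C rk"
  proof
    have card: "card X \<le> card E" if "X \<in> C" for X
      using that fin C by (simp add: card_mono)
    then show "\<exists>d. \<forall>X\<in>C. card X \<le> d"
      by blast
    have "rk X \<le> card E" if "X \<in> C" for X
      using R(1) that card[OF that] unfolding R1_def by (meson order_trans)
    then show "\<exists>r. \<forall>X\<in>C. rk X \<le> r"
      by blast
    show "CR1 C rk"
      using C by (auto simp: CR1_def)
    show "CR2 C rk"
      unfolding CR2_def
    proof (intro ballI impI)
      fix X Y assume XY: "X \<in> C" "Y \<in> C" "rk X < rk Y"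
      then have "\<not> Y \<subseteq> X"
        using R(2) unfolding R2_def by (meson leD)
      then show "\<exists>y \<in> Y - X. X \<union> {y} \<in> C"
        using XY C by auto
    qed
    show "finite X" if "X \<in> C" for X
      using that fin C by (simp add: finite_subset)
  qed (use C R in auto)
  then show "matroid_triple E C rk"
    using fin C by (simp add: matroid_triple_def)
qed


section \<open>Group actions on semimatroids\<close>

text \<open>Since \<open>preserves_central\<close> is required of every group element, hence also of inverses, it
  makes centrality of \<open>X\<close> and of its translates equivalent.\<close>

locale G_semimatroid = group_action G S \<phi> + finitary_semimatroid S C rk
  for G :: "('g, 'm) monoid_scheme" (structure) and S :: "'a set"
    and \<phi> :: "'g \<Rightarrow> 'a \<Rightarrow> 'a" and C :: "'a set set" and rk :: "'a set \<Rightarrow> nat" +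
  assumes preserves_central: "\<lbrakk>g \<in> carrier G; X \<in> C\<rbrakk> \<Longrightarrow> \<phi> g ` X \<in> C"
    and preserves_rank: "\<lbrakk>g \<in> carrier G; X \<in> C\<rbrakk> \<Longrightarrow> rk (\<phi> g ` X) = rk X"

text \<open>The set of orbits of elements of \<open>X\<close>, written \<open>X\<close> with an underline in the literature.\<close>

definition orbit_image :: "('g, 'm) monoid_scheme \<Rightarrow> ('g \<Rightarrow> 'a \<Rightarrow> 'a) \<Rightarrow> 'a set \<Rightarrow> 'a set set" where
  "orbit_image G \<phi> X = orbit G \<phi> ` X"

definition orbit_complex ::
    "('g, 'm) monoid_scheme \<Rightarrow> ('g \<Rightarrow> 'a \<Rightarrow> 'a) \<Rightarrow> 'a set set \<Rightarrow> 'a set set set" where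
  "orbit_complex G \<phi> C = {orbit_image G \<phi> X | X. X \<in> C}"

text \<open>In a \<open>G_semimatroid\<close> this is the maximum of a finite set, because \<open>rk\<close> is bounded on \<open>C\<close>,
  and of a non-empty one, because \<open>{}\<close> is central.\<close>

definition orbit_rank ::
    "('g, 'm) monoid_scheme \<Rightarrow> ('g \<Rightarrow> 'a \<Rightarrow> 'a) \<Rightarrow> 'a set set \<Rightarrow> ('a set \<Rightarrow> nat) \<Rightarrow>
      'a set set \<Rightarrow> nat" where
  "orbit_rank G \<phi> C rk A = Max {rk X | X. X \<in> C \<and> orbit_image G \<phi> X \<subseteq> A}"

text \<open>Finiteness of the set of orbits of the induced action on central sets.\<close>

definition cofinite_action ::
    "('g, 'm) monoid_scheme \<Rightarrow> ('g \<Rightarrow> 'a \<Rightarrow> 'a) \<Rightarrow> 'a set set \<Rightarrow> bool" where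
  "cofinite_action G \<phi> C \<longleftrightarrow> finite (orbits G C (\<lambda>g X. \<phi> g ` X))"

definition centered_action ::
    "('g, 'm) monoid_scheme \<Rightarrow> 'a set \<Rightarrow> ('g \<Rightarrow> 'a \<Rightarrow> 'a) \<Rightarrow> 'a set set \<Rightarrow> bool" where
  "centered_action G S \<phi> C \<longleftrightarrow> (\<exists>X\<in>C. orbit_image G \<phi> X = orbits G S \<phi>)"

definition weakly_translative ::
    "('g, 'm) monoid_scheme \<Rightarrow> 'a set \<Rightarrow> ('g \<Rightarrow> 'a \<Rightarrow> 'a) \<Rightarrow> 'a set set \<Rightarrow> ('a set \<Rightarrow> nat) \<Rightarrow> bool"
  where
  "weakly_translative G S \<phi> C rk \<longleftrightarrow>
    (\<forall>g \<in> carrier G. \<forall>x\<in>S. {x, \<phi> g x} \<in> C \<longrightarrow> rk {x, \<phi> g x} = rk {x})"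

end

theory Submission
  imports Defs
begin

text \<open>
  The proof rests on one consequence of \<open>CR2\<close>: a central set \<open>X\<close> can be enlarged by elements of
  any central set \<open>Y\<close> until it has at least the rank of \<open>Y\<close>, remaining central all the way
  (\<open>extend_to_rank\<close>). Let \<open>r P\<close> be the largest rank of a central subset of \<open>P \<subseteq> S\<close>. Extend a
  central set realising \<open>r (P \<inter> Q)\<close> to a central \<open>Z\<close> realising \<open>r (P \<union> Q)\<close>. As \<open>Z \<inter> P\<close>,
  \<open>Z \<inter> Q\<close> and their union \<open>Z\<close> are central, \<open>R3\<close> applies to them and shows that \<open>r\<close> is
  submodular (\<open>restriction_rank_submodular\<close>). The rank of a set of orbits is \<open>r\<close> of the union of
  these orbits, so orbits carry a polymatroid.

  By submodularity a polymatroid is a matroid as soon as singletons have rank at most one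
  (\<open>matroid_iff_singletons\<close>), so the second claim is about a single orbit. If the action is weakly
  translative, the elements of a central subset of an orbit are pairwise parallel or all loops, and
  hence the subset has the rank of a singleton (\<open>rank_le_of_parallel\<close>). Conversely, if an orbit has rank at most
  one, then a central pair \<open>{x, g x}\<close> has rank at most one; it cannot have larger rank than \<open>{x}\<close>,
  because if \<open>x\<close> is a loop then so is its translate \<open>g x\<close>.

  Images of central sets are closed under subsets because one may restrict a central set to the
  preimage of the subset; so they form a complex, and this complex is the full power set exactly
  when it contains the set of all orbits, that is, when the action is centered. For \<open>CR2\<close> on
  orbits, extend a central lift \<open>X\<close> of \<open>A\<close> by elements of a central set realising the rank of
  \<open>B\<close>. The result has rank larger than that of \<open>A\<close>, so it must contain an element outside the
  orbits in \<open>A\<close>, and the orbit of this element can be added to \<open>A\<close>.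
\<close>

section \<open>Ranks of restrictions\<close>

definition restriction_rank :: "'a set set \<Rightarrow> ('a set \<Rightarrow> nat) \<Rightarrow> 'a set \<Rightarrow> nat" where
  "restriction_rank C rk P = Max {rk X | X. X \<in> C \<and> X \<subseteq> P}"

context findim_simplicial_complex
begin

lemma empty_central: "{} \<in> C"
  using nonempty down_closed by blast

end

context locally_ranked_triple
begin

lemma rank_mono: "\<lbrakk>Y \<in> C; X \<subseteq> Y\<rbrakk> \<Longrightarrow> rk X \<le> rk Y"
  using R2 down_closed unfolding R2_def by blast

lemma rank_submodular: "X \<union> Y \<in> C \<Longrightarrow> rk (X \<union> Y) + rk (X \<inter> Y) \<le> rk X + rk Y"
  using R3 down_closed unfolding R3_def by (meson Un_upper1 Un_upper2)

lemma rank_singleton_le_1: "x \<in> S \<Longrightarrow> rk {x} \<le> 1"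
  using R1 singletons unfolding R1_def by fastforce

lemma rank_empty: "rk {} = 0"
  using R1 empty_central unfolding R1_def by fastforce

lemma finite_restriction_ranks: "finite {rk X | X. X \<in> C \<and> X \<subseteq> P}"
proof -
  obtain r where "\<forall>X\<in>C. rk X \<le> r"
    using bounded_rank by blast
  then have "{rk X | X. X \<in> C \<and> X \<subseteq> P} \<subseteq> {..r}"
    by auto
  then show ?thesis
    by (rule finite_subset) simp
qed

lemma rank_le_restriction_rank: "\<lbrakk>X \<in> C; X \<subseteq> P\<rbrakk> \<Longrightarrow> rk X \<le> restriction_rank C rk P"
  unfolding restriction_rank_def by (rule Max_ge[OF finite_restriction_ranks]) blast

lemma restriction_rank_attained:
  obtains X where "X \<in> C" "X \<subseteq> P" "rk X = restriction_rank C rk P"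
proof -
  have "{rk X | X. X \<in> C \<and> X \<subseteq> P} \<noteq> {}"
    using empty_central by blast
  from Max_in[OF finite_restriction_ranks this]
  show ?thesis
    using that unfolding restriction_rank_def by auto
qed

lemma restriction_rank_mono:
  "P \<subseteq> Q \<Longrightarrow> restriction_rank C rk P \<le> restriction_rank C rk Q"
  by (metis order_trans rank_le_restriction_rank restriction_rank_attained)

text \<open>Submodularity lets elements that do not raise the rank of \<open>{x}\<close> individually be adjoined one
  after another without ever raising it: the closure of \<open>x\<close> within a central set has rank
  \<open>rk {x}\<close>.\<close>

lemma rank_le_of_parallel:
  assumes X: "X \<in> C" "x \<in> X" and par: "\<And>y. y \<in> X \<Longrightarrow> rk {x, y} \<le> rk {x}"
  shows "rk X \<le> rk {x}"
proof -
  have "rk (insert x F) \<le> rk {x}" if "finite F" "F \<subseteq> X" for F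
    using that
  proof (induction F rule: finite_induct)
    case empty
    then show ?case by simp
  next
    case (insert y F)
    have U: "insert x F \<union> {x, y} = insert x (insert y F)"
      by blast
    then have C: "insert x F \<union> {x, y} \<in> C"
      using insert.prems X by (auto intro: down_closed)
    have "rk {x} \<le> rk (insert x F \<inter> {x, y})"
      using C by (intro rank_mono) (auto intro: down_closed[OF C])
    moreover have "rk (insert x F \<union> {x, y}) + rk (insert x F \<inter> {x, y})
        \<le> rk (insert x F) + rk {x, y}"
      by (rule rank_submodular[OF C])
    moreover have "rk {x, y} \<le> rk {x}" "rk (insert x F) \<le> rk {x}"
      using par insert.IH insert.prems by auto
    ultimately show ?case
      using U by simp
  qed
  from this[of X] show ?thesis
    using X finite_simplex by (simp add: insert_absorb)
qed

end

context finitary_semimatroid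
begin

text \<open>A single application of \<open>CR2\<close> adds an element but need not raise the rank. The iteration
  stops nevertheless, since at most the elements of the finite set \<open>Y\<close> can be added.\<close>

lemma extend_to_rank:
  assumes "X \<in> C" "Y \<in> C"
  obtains Z where "Z \<in> C" "X \<subseteq> Z" "Z \<subseteq> X \<union> Y" "rk Y \<le> rk Z"
proof -
  have "\<exists>Z\<in>C. X \<subseteq> Z \<and> Z \<subseteq> X \<union> Y \<and> rk Y \<le> rk Z"
    using assms(1)
  proof (induction "card (Y - X)" arbitrary: X rule: less_induct)
    case less
    show ?case
    proof (cases "rk Y \<le> rk X")
      case True
      then show ?thesis
        using less.prems by blast
    next
      case False
      then obtain y where y: "y \<in> Y - X" "X \<union> {y} \<in> C"
        using CR2 less.prems assms(2) unfolding CR2_def by (meson not_le)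
      then have "card (Y - (X \<union> {y})) < card (Y - X)"
        using finite_simplex[OF assms(2)] by (intro psubset_card_mono) auto
      from less.hyps[OF this y(2)] show ?thesis
        using y(1) by blast
    qed
  qed
  then show ?thesis
    using that by blast
qed

text \<open>\<open>R3\<close> compares only sets whose union is central, and sets realising the ranks of \<open>P\<close> and \<open>Q\<close>
  need not have a central union. A central \<open>Z\<close> realising the rank of \<open>P \<union> Q\<close> supplies such sets,
  \<open>Z \<inter> P\<close> and \<open>Z \<inter> Q\<close>; it must in addition contain a set realising the rank of \<open>P \<inter> Q\<close>, so
  that their intersection is large enough.\<close>

lemma restriction_rank_submodular:
  "restriction_rank C rk (P \<union> Q) + restriction_rank C rk (P \<inter> Q)
    \<le> restriction_rank C rk P + restriction_rank C rk Q"
proof -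
  obtain X where X: "X \<in> C" "X \<subseteq> P \<inter> Q" "rk X = restriction_rank C rk (P \<inter> Q)"
    by (rule restriction_rank_attained)
  obtain Y where Y: "Y \<in> C" "Y \<subseteq> P \<union> Q" "rk Y = restriction_rank C rk (P \<union> Q)"
    by (rule restriction_rank_attained)
  obtain Z where Z: "Z \<in> C" "X \<subseteq> Z" "Z \<subseteq> X \<union> Y" "rk Y \<le> rk Z"
    using extend_to_rank[OF X(1) Y(1)] .
  have U: "(Z \<inter> P) \<union> (Z \<inter> Q) = Z"
    using X Y Z by blast
  have "rk X \<le> rk ((Z \<inter> P) \<inter> (Z \<inter> Q))"
    using X Z by (intro rank_mono) (auto intro: down_closed[OF Z(1)])
  then have "rk Y + rk X \<le> rk Z + rk ((Z \<inter> P) \<inter> (Z \<inter> Q))"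
    using Z(4) by simp
  also have "\<dots> \<le> rk (Z \<inter> P) + rk (Z \<inter> Q)"
    using rank_submodular[of "Z \<inter> P" "Z \<inter> Q"] Z(1) U by simp
  also have "\<dots> \<le> restriction_rank C rk P + restriction_rank C rk Q"
    using Z(1) by (intro add_mono rank_le_restriction_rank) (auto intro: down_closed)
  finally show ?thesis
    using X(3) Y(3) by simp
qed

end

section \<open>Matroids among polymatroids\<close>

text \<open>By submodularity an additional element raises the rank by at most its own rank.\<close>

lemma matroid_iff_singletons:
  assumes "polymatroid E r"
  shows "matroid E r \<longleftrightarrow> (\<forall>e\<in>E. r {e} \<le> 1)"
proof
  assume "matroid E r"
  then have "r {e} \<le> card {e}" if "e \<in> E" for e
    using that unfolding matroid_def R1_def by blast
  then show "\<forall>e\<in>E. r {e} \<le> 1"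
    by simp
next
  assume single: "\<forall>e\<in>E. r {e} \<le> 1"
  have fin: "finite E" and R: "R2 (Pow E) r" "R3 (Pow E) r" and r0: "r {} = 0"
    using assms by (auto simp: polymatroid_def)
  have "r A \<le> card A" if "A \<subseteq> E" for A
    using finite_subset[OF that fin] that
  proof (induction A rule: finite_induct)
    case empty
    then show ?case by (simp add: r0)
  next
    case (insert e A)
    have "r (A \<union> {e}) + r (A \<inter> {e}) \<le> r A + r {e}"
      using R(2)[unfolded R3_def, THEN bspec, of A, THEN bspec, of "{e}"] insert.prems by simp
    then show ?case
      using single insert by force
  qed
  then show "matroid E r"
    using fin R by (simp add: matroid_def R1_def)
qed

section \<open>Orbits of central sets\<close>

context G_semimatroid
begin

lemma orbit_memD: "y \<in> orbit G \<phi> x \<Longrightarrow> \<exists>g\<in>carrier G. y = \<phi> g x"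
  by (auto simp: orbit_def)

lemma orbit_translate:
  assumes g: "g \<in> carrier G" and x: "x \<in> S"
  shows "orbit G \<phi> (\<phi> g x) = orbit G \<phi> x"
proof -
  have y: "\<phi> g x \<in> S" "\<phi> g x \<in> orbit G \<phi> x"
    using element_image[OF g x refl] g by (auto simp: orbit_def)
  have "z \<in> S" if "z \<in> orbit G \<phi> x \<or> z \<in> orbit G \<phi> (\<phi> g x)" for z
    using that x y(1) element_image by (auto simp: orbit_def)
  then show ?thesis
    using orbit_trans[OF x y(1) _ y(2)] orbit_trans[OF y(1) x _ orbit_sym[OF x y]] by blast
qed

lemma orbit_image_subset_iff:
  "X \<subseteq> S \<Longrightarrow> orbit_image G \<phi> X \<subseteq> A \<longleftrightarrow> X \<subseteq> {x \<in> S. orbit G \<phi> x \<in> A}"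
  by (auto simp: orbit_image_def)

lemma orbit_rank_eq_restriction_rank:
  "orbit_rank G \<phi> C rk A = restriction_rank C rk {x \<in> S. orbit G \<phi> x \<in> A}"
proof -
  have "{X \<in> C. orbit_image G \<phi> X \<subseteq> A} = {X \<in> C. X \<subseteq> {x \<in> S. orbit G \<phi> x \<in> A}}"
    using orbit_image_subset_iff subset_ground by blast
  then show ?thesis
    unfolding orbit_rank_def restriction_rank_def
    by (intro arg_cong[where f = Max]) blast
qed

lemma rank_le_orbit_rank:
  "\<lbrakk>X \<in> C; orbit_image G \<phi> X \<subseteq> A\<rbrakk> \<Longrightarrow> rk X \<le> orbit_rank G \<phi> C rk A"
  unfolding orbit_rank_eq_restriction_rank
  by (rule rank_le_restriction_rank) (simp_all add: orbit_image_subset_iff[symmetric] subset_ground)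

lemma orbit_rank_attained:
  obtains X where "X \<in> C" "orbit_image G \<phi> X \<subseteq> A" "rk X = orbit_rank G \<phi> C rk A"
proof -
  obtain X where X: "X \<in> C" "X \<subseteq> {x \<in> S. orbit G \<phi> x \<in> A}"
      "rk X = restriction_rank C rk {x \<in> S. orbit G \<phi> x \<in> A}"
    by (rule restriction_rank_attained)
  then have "orbit_image G \<phi> X \<subseteq> A"
    by (auto simp: orbit_image_def)
  then show ?thesis
    using that X by (simp add: orbit_rank_eq_restriction_rank)
qed

text \<open>The singletons in \<open>S\<close> are central, and the union of the orbit of \<open>{x}\<close> under the action on
  central sets is the orbit of \<open>x\<close>.\<close>

lemma finite_orbits:
  assumes "cofinite_action G \<phi> C"
  shows "finite (orbits G S \<phi>)"
proof -
  have "orbits G S \<phi> \<subseteq> Union ` orbits G C (\<lambda>g X. \<phi> g ` X)"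
  proof
    fix e assume "e \<in> orbits G S \<phi>"
    then obtain x where x: "x \<in> S" "e = orbit G \<phi> x"
      by (auto simp: orbits_def)
    have "e = \<Union> (orbit G (\<lambda>g X. \<phi> g ` X) {x})"
      using x(2) by (auto simp: orbit_def)
    moreover have "orbit G (\<lambda>g X. \<phi> g ` X) {x} \<in> orbits G C (\<lambda>g X. \<phi> g ` X)"
      using singletons[OF x(1)] by (auto simp: orbits_def)
    ultimately show "e \<in> Union ` orbits G C (\<lambda>g X. \<phi> g ` X)"
      by blast
  qed
  then show ?thesis
    using assms finite_surj unfolding cofinite_action_def by blast
qed

lemma polymatroid_orbit_rank:
  assumes "cofinite_action G \<phi> C"
  shows "polymatroid (orbits G S \<phi>) (orbit_rank G \<phi> C rk)"
  unfolding polymatroid_def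
proof (intro conjI)
  let ?P = "\<lambda>A. {x \<in> S. orbit G \<phi> x \<in> A}"
  show "finite (orbits G S \<phi>)"
    by (rule finite_orbits[OF assms])
  show "R2 (Pow (orbits G S \<phi>)) (orbit_rank G \<phi> C rk)"
    unfolding R2_def orbit_rank_eq_restriction_rank by (auto intro!: restriction_rank_mono)
  have "?P (A \<union> B) = ?P A \<union> ?P B" "?P (A \<inter> B) = ?P A \<inter> ?P B" for A B
    by auto
  then show "R3 (Pow (orbits G S \<phi>)) (orbit_rank G \<phi> C rk)"
    by (simp add: R3_def orbit_rank_eq_restriction_rank restriction_rank_submodular)
  obtain X where "X \<in> C" "orbit_image G \<phi> X \<subseteq> {}" "rk X = orbit_rank G \<phi> C rk {}"
    by (rule orbit_rank_attained)
  then show "orbit_rank G \<phi> C rk {} = 0"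
    using rank_empty by (simp add: orbit_image_def)
qed

text \<open>In a weakly translative action the elements of a central subset of an orbit are pairwise
  parallel (or all loops), which leaves no room for rank two.\<close>

lemma weakly_translative_orbit_rank_le_1:
  assumes wt: "weakly_translative G S \<phi> C rk" and e: "e \<in> orbits G S \<phi>"
  shows "orbit_rank G \<phi> C rk {e} \<le> 1"
proof -
  obtain X where X: "X \<in> C" "orbit_image G \<phi> X \<subseteq> {e}" "rk X = orbit_rank G \<phi> C rk {e}"
    by (rule orbit_rank_attained)
  have "rk X \<le> 1"
  proof (cases "X = {}")
    case True
    then show ?thesis by (simp add: rank_empty)
  next
    case False
    then obtain x where x: "x \<in> X"
      by blast
    have XS: "X \<subseteq> S"
      using X(1) by (rule subset_ground)
    have "rk {x, y} \<le> rk {x}" if y: "y \<in> X" for y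
    proof -
      have "y \<in> orbit G \<phi> y"
        using XS y orbit_refl by blast
      moreover have "orbit G \<phi> y = orbit G \<phi> x"
        using X(2) x y by (auto simp: orbit_image_def)
      ultimately obtain g where g: "g \<in> carrier G" "y = \<phi> g x"
        using orbit_memD by blast
      moreover have "{x, y} \<in> C"
        using X(1) x y by (auto intro: down_closed)
      ultimately show ?thesis
        using wt x XS unfolding weakly_translative_def by auto
    qed
    then have "rk X \<le> rk {x}"
      by (rule rank_le_of_parallel[OF X(1) x])
    then show ?thesis
      using rank_singleton_le_1 x XS by fastforce
  qed
  then show ?thesis
    by (simp add: X(3))
qed

lemma weakly_translative_if_orbit_rank_le_1:
  assumes single: "\<And>e. e \<in> orbits G S \<phi> \<Longrightarrow> orbit_rank G \<phi> C rk {e} \<le> 1"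
  shows "weakly_translative G S \<phi> C rk"
  unfolding weakly_translative_def
proof (intro ballI impI)
  fix g x assume g: "g \<in> carrier G" and x: "x \<in> S" and pair: "{x, \<phi> g x} \<in> C"
  have "rk {x, \<phi> g x} \<le> orbit_rank G \<phi> C rk {orbit G \<phi> x}"
    by (intro rank_le_orbit_rank[OF pair]) (auto simp: orbit_image_def orbit_translate[OF g x])
  also have "\<dots> \<le> 1"
    using x by (intro single) (auto simp: orbits_def)
  finally have le1: "rk {x, \<phi> g x} \<le> 1" .
  (* Rank is invariant under the action, so a translate of a loop is a loop. *)
  have "rk {\<phi> g x} = rk {x}"
    using preserves_rank[OF g singletons[OF x]] by simp
  moreover have "rk {x, \<phi> g x} \<le> rk {x} + rk {\<phi> g x}"
    using rank_submodular[of "{x}" "{\<phi> g x}"] pair by (simp add: insert_commute)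
  moreover have "rk {x} \<le> rk {x, \<phi> g x}"
    using pair by (intro rank_mono) auto
  ultimately show "rk {x, \<phi> g x} = rk {x}"
    using le1 by linarith
qed

lemma matroid_orbit_rank_iff:
  assumes "cofinite_action G \<phi> C"
  shows "matroid (orbits G S \<phi>) (orbit_rank G \<phi> C rk) \<longleftrightarrow> weakly_translative G S \<phi> C rk"
  unfolding matroid_iff_singletons[OF polymatroid_orbit_rank[OF assms]]
proof
  show "weakly_translative G S \<phi> C rk" if "\<forall>e\<in>orbits G S \<phi>. orbit_rank G \<phi> C rk {e} \<le> 1"
    using that by (intro weakly_translative_if_orbit_rank_le_1) (rule bspec)
  show "\<forall>e\<in>orbits G S \<phi>. orbit_rank G \<phi> C rk {e} \<le> 1" if "weakly_translative G S \<phi> C rk"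
    using weakly_translative_orbit_rank_le_1[OF that] by (rule ballI)
qed

section \<open>The complex of orbit sets\<close>

lemma orbit_complex_subset:
  assumes "A \<in> orbit_complex G \<phi> C"
  shows "A \<subseteq> orbits G S \<phi>"
proof -
  obtain X where "X \<in> C" "A = orbit G \<phi> ` X"
    using assms by (auto simp: orbit_complex_def orbit_image_def)
  then show ?thesis
    using subset_ground[of X] by (auto simp: orbits_def)
qed

lemma orbit_complex_down_closed:
  assumes "A \<in> orbit_complex G \<phi> C" "B \<subseteq> A"
  shows "B \<in> orbit_complex G \<phi> C"
proof -
  obtain X where X: "X \<in> C" "A = orbit G \<phi> ` X"
    using assms(1) by (auto simp: orbit_complex_def orbit_image_def)
  have "B = orbit G \<phi> ` {x \<in> X. orbit G \<phi> x \<in> B}"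
    using assms(2) X(2) by auto
  moreover have "{x \<in> X. orbit G \<phi> x \<in> B} \<in> C"
    by (rule down_closed[OF X(1)]) auto
  ultimately show ?thesis
    unfolding orbit_complex_def orbit_image_def by blast
qed

lemma findim_orbit_complex:
  assumes "finite (orbits G S \<phi>)"
  shows "findim_simplicial_complex (orbits G S \<phi>) (orbit_complex G \<phi> C)"
proof
  show "orbit_complex G \<phi> C \<noteq> {}"
    using nonempty by (auto simp: orbit_complex_def)
  show "finite A" if "A \<in> orbit_complex G \<phi> C" for A
    using that assms orbit_complex_subset finite_subset by blast
  show "\<exists>d. \<forall>A\<in>orbit_complex G \<phi> C. card A \<le> d"
    using assms orbit_complex_subset card_mono by metis
  show "{e} \<in> orbit_complex G \<phi> C" if e: "e \<in> orbits G S \<phi>" for e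
  proof -
    obtain x where "x \<in> S" "e = orbit G \<phi> x"
      using e by (auto simp: orbits_def)
    then have "{x} \<in> C" "{e} = orbit_image G \<phi> {x}"
      using singletons by (auto simp: orbit_image_def)
    then show ?thesis
      unfolding orbit_complex_def by blast
  qed
qed (rule orbit_complex_subset orbit_complex_down_closed; assumption)+

lemma locally_ranked_triple_orbits:
  assumes m: "matroid (orbits G S \<phi>) (orbit_rank G \<phi> C rk)"
  shows "locally_ranked_triple (orbits G S \<phi>) (orbit_complex G \<phi> C) (orbit_rank G \<phi> C rk)"
proof -
  have fin: "finite (orbits G S \<phi>)"
    and R: "R1 (Pow (orbits G S \<phi>)) (orbit_rank G \<phi> C rk)"
      "R2 (Pow (orbits G S \<phi>)) (orbit_rank G \<phi> C rk)"
      "R3 (Pow (orbits G S \<phi>)) (orbit_rank G \<phi> C rk)"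
    using m by (auto simp: matroid_def)
  have sub: "orbit_complex G \<phi> C \<subseteq> Pow (orbits G S \<phi>)"
    using orbit_complex_subset by blast
  interpret quotient: findim_simplicial_complex "orbits G S \<phi>" "orbit_complex G \<phi> C"
    by (rule findim_orbit_complex[OF fin])
  show ?thesis
  proof
    show R1': "R1 (orbit_complex G \<phi> C) (orbit_rank G \<phi> C rk)"
      using R(1) sub unfolding R1_def by blast
    show "R2 (orbit_complex G \<phi> C) (orbit_rank G \<phi> C rk)"
      using R(2) sub unfolding R2_def by blast
    show "R3 (orbit_complex G \<phi> C) (orbit_rank G \<phi> C rk)"
      using R(3) sub unfolding R3_def by blast
    show "\<exists>r. \<forall>A\<in>orbit_complex G \<phi> C. orbit_rank G \<phi> C rk A \<le> r"
      using R1' quotient.bounded_card unfolding R1_def by (meson order_trans)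
  qed
qed

text \<open>The comparison is between a lift of \<open>A\<close>, whose rank is at most that of \<open>A\<close>, and a central
  set realising the rank of \<open>B\<close>, whose image may be smaller than \<open>B\<close>. Adding elements with orbits
  in \<open>A\<close> cannot push the rank beyond that of \<open>A\<close>, so the extension meets a new orbit.\<close>

lemma CR2_orbits: "CR2 (orbit_complex G \<phi> C) (orbit_rank G \<phi> C rk)"
  unfolding CR2_def
proof (intro ballI impI)
  fix A B
  assume A: "A \<in> orbit_complex G \<phi> C" and lt: "orbit_rank G \<phi> C rk A < orbit_rank G \<phi> C rk B"
  obtain X where X: "X \<in> C" "A = orbit_image G \<phi> X"
    using A by (auto simp: orbit_complex_def)
  obtain Y where Y: "Y \<in> C" "orbit_image G \<phi> Y \<subseteq> B" "rk Y = orbit_rank G \<phi> C rk B"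
    by (rule orbit_rank_attained)
  obtain Z where Z: "Z \<in> C" "X \<subseteq> Z" "Z \<subseteq> X \<union> Y" "rk Y \<le> rk Z"
    using extend_to_rank[OF X(1) Y(1)] .
  have "\<not> orbit_image G \<phi> Z \<subseteq> A"
    using rank_le_orbit_rank[OF Z(1), of A] Z(4) Y(3) lt by linarith
  then obtain z where z: "z \<in> Z" "orbit G \<phi> z \<notin> A"
    by (auto simp: orbit_image_def)
  then have "orbit G \<phi> z \<in> B - A"
    using Z(3) X(2) Y(2) by (auto simp: orbit_image_def)
  moreover have "A \<union> {orbit G \<phi> z} \<in> orbit_complex G \<phi> C"
  proof -
    have "X \<union> {z} \<in> C"
      using Z(2) z(1) by (intro down_closed[OF Z(1)]) auto
    moreover have "A \<union> {orbit G \<phi> z} = orbit_image G \<phi> (X \<union> {z})"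
      by (simp add: X(2) orbit_image_def)
    ultimately show ?thesis
      unfolding orbit_complex_def by blast
  qed
  ultimately show "\<exists>e \<in> B - A. A \<union> {e} \<in> orbit_complex G \<phi> C"
    by blast
qed

lemma orbit_complex_eq_Pow_iff:
  "orbit_complex G \<phi> C = Pow (orbits G S \<phi>) \<longleftrightarrow> centered_action G S \<phi> C"
proof -
  have "centered_action G S \<phi> C \<longleftrightarrow> orbits G S \<phi> \<in> orbit_complex G \<phi> C"
    unfolding centered_action_def orbit_complex_def by auto
  then show ?thesis
    using orbit_complex_subset orbit_complex_down_closed by blast
qed

end

section \<open>The polymatroid of a group action on a semimatroid\<close>

theorem theorem1:
  fixes G :: "('g, 'm) monoid_scheme" and S :: "'a set" and \<phi> :: "'g \<Rightarrow> 'a \<Rightarrow> 'a"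
    and C :: "'a set set" and rk :: "'a set \<Rightarrow> nat"
  assumes "G_semimatroid G S \<phi> C rk"
    and "cofinite_action G \<phi> C"
  shows "polymatroid (orbits G S \<phi>) (orbit_rank G \<phi> C rk)
    \<and> (matroid (orbits G S \<phi>) (orbit_rank G \<phi> C rk) \<longleftrightarrow> weakly_translative G S \<phi> C rk)
    \<and> (weakly_translative G S \<phi> C rk \<longrightarrow>
         locally_ranked_triple (orbits G S \<phi>) (orbit_complex G \<phi> C) (orbit_rank G \<phi> C rk)
         \<and> CR2 (orbit_complex G \<phi> C) (orbit_rank G \<phi> C rk)
         \<and> (matroid_triple (orbits G S \<phi>) (orbit_complex G \<phi> C) (orbit_rank G \<phi> C rk)
              \<longleftrightarrow> centered_action G S \<phi> C))"
proof -
  interpret G_semimatroid G S \<phi> C rk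
    by (rule assms(1))
  show ?thesis
    using polymatroid_orbit_rank[OF assms(2)] matroid_orbit_rank_iff[OF assms(2)]
      locally_ranked_triple_orbits CR2_orbits
    by (simp add: matroid_triple_iff orbit_complex_eq_Pow_iff)
qed

end
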